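(* Let $1<p,q<\infty$ and let $\sigma,w$ be Radon measures on $\mathbb{R}^N$. Let $\mathscr{S}=\mathscr{S}(\sigma,w,p,q)\in[0,\infty]$ be the smallest constant such that for every collection $\{f_Q\}_{Q\in\mathscr{D}}$ of locally $\sigma$-integrable functions $$\Big\|\Big(\sum_{Q\in\mathscr{D}}\Big(\frac{\int_Qf_Q\,d\sigma}{|Q|}\Big)^21_Q\Big)^{1/2}\Big\|_{L^q(w)}\le\mathscr{S}\Big\|\Big(\sum_{Q\in\mathscr{D}}f_Q^21_Q\Big)^{1/2}\Big\|_{L^p(\sigma)}.$$ Then $\mathscr{S}\simeq[\sigma,w]_{p,q}$, with implicit constants depending only on $p$ and $q$ (in particular one is finite if and only if the other is).
   Context: All functions are real valued. A dyadic lattice $\mathscr{D}=\bigcup_{k\in\mathbb{Z}}\mathscr{D}_k$ on $\mathbb{R}^N$ is fixed: each $\mathscr{D}_k$ is a disjoint cover of $\mathbb{R}^N$ by cubes of the form $x+[0,2^{-k})^N$, and every cube in $\mathscr{D}_k$ is a union of $2^N$ cubes of $\mathscr{D}_{k+1}$. $|Q|$ is the Lebesgue measure of $Q$. The quadratic $\mathscr{A}_{p,q}$-constant $[\sigma,w]_{p,q}\in[0,\infty]$ is the best constant such that for every collection $\{a_Q\}_{Q\in\mathscr{D}}\subset\mathbb{R}$ $$\Big\|\Big(\sum_{Q\in\mathscr{D}}\Big(a_Q\frac{\sigma(Q)}{|Q|}\Big)^21_Q\Big)^{1/2}\Big\|_{L^q(w)}\le[\sigma,w]_{p,q}\Big\|\Big(\sum_{Q\in\mathscr{D}}a_Q^21_Q\Big)^{1/2}\Big\|_{L^p(\sigma)}.$$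 *)

theory Defs
  imports "HOL-Analysis.Analysis"
begin

text \<open>
  The space \<open>\<real>\<^sup>N\<close> is represented by the extensional functions on \<open>{..<N}\<close>, i.e. as a finite
  product space, so that \<open>N\<close> is an ordinary variable. A type-indexed dimension could not express
  that a constant is independent of \<open>N\<close>.
\<close>

abbreviation Rn_space :: "nat \<Rightarrow> (nat \<Rightarrow> real) set" where
  "Rn_space N \<equiv> {..<N} \<rightarrow>\<^sub>E UNIV"

abbreviation Rn_topology :: "nat \<Rightarrow> (nat \<Rightarrow> real) topology" where
  "Rn_topology N \<equiv> product_topology (\<lambda>_. euclideanreal) {..<N}"

abbreviation Rn_borel :: "nat \<Rightarrow> (nat \<Rightarrow> real) measure" where
  "Rn_borel N \<equiv> \<Pi>\<^sub>M i\<in>{..<N}. borel"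

abbreviation Rn_lebesgue :: "nat \<Rightarrow> (nat \<Rightarrow> real) measure" where
  "Rn_lebesgue N \<equiv> \<Pi>\<^sub>M i\<in>{..<N}. lborel"

text \<open>
  On \<open>\<real>\<^sup>N\<close> every Borel measure that is finite on compact sets is regular, so regularity is not
  listed separately.
\<close>

definition radon_measure :: "nat \<Rightarrow> (nat \<Rightarrow> real) measure \<Rightarrow> bool" where
  "radon_measure N M \<longleftrightarrow>
     sets M = sets (Rn_borel N) \<and>
     (\<forall>K. compactin (Rn_topology N) K \<longrightarrow> emeasure M K < \<infinity>)"

definition locally_integrable ::
    "nat \<Rightarrow> (nat \<Rightarrow> real) measure \<Rightarrow> ((nat \<Rightarrow> real) \<Rightarrow> real) \<Rightarrow> bool" where
  "locally_integrable N M f \<longleftrightarrow>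
     f \<in> borel_measurable M \<and>
     (\<forall>K. compactin (Rn_topology N) K \<longrightarrow> set_integrable M K f)"

definition dyadic_cube :: "nat \<Rightarrow> int \<Rightarrow> (nat \<Rightarrow> real) \<Rightarrow> (nat \<Rightarrow> real) set" where
  "dyadic_cube N k x = (\<Pi>\<^sub>E i\<in>{..<N}. {x i ..< x i + 2 powi (-k)})"

definition dyadic_lattice :: "nat \<Rightarrow> (int \<Rightarrow> (nat \<Rightarrow> real) set set) \<Rightarrow> bool" where
  "dyadic_lattice N \<D> \<longleftrightarrow>
     (\<forall>k. (\<forall>Q\<in>\<D> k. \<exists>x\<in>Rn_space N. Q = dyadic_cube N k x) \<and>
          disjoint (\<D> k) \<and> \<Union>(\<D> k) = Rn_space N \<and>
          (\<forall>Q\<in>\<D> k. \<exists>\<C>\<subseteq>\<D> (k + 1). card \<C> = 2 ^ N \<and> Q = \<Union>\<C>))"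

text \<open>Real powers on \<open>[0,\<infinity>]\<close>; only meant for exponents \<open>r > 0\<close>.\<close>

definition ennpowr :: "ennreal \<Rightarrow> real \<Rightarrow> ennreal" where
  "ennpowr t r = (if t = \<infinity> then \<infinity> else ennreal (enn2real t powr r))"

definition Lp_norm :: "real \<Rightarrow> 'a measure \<Rightarrow> ('a \<Rightarrow> ennreal) \<Rightarrow> ennreal" where
  "Lp_norm p M F = ennpowr (\<integral>\<^sup>+x. ennpowr (F x) p \<partial>M) (1 / p)"

definition square_function :: "'a set set \<Rightarrow> ('a set \<Rightarrow> 'a \<Rightarrow> real) \<Rightarrow> 'a \<Rightarrow> ennreal" where
  "square_function D f x = ennpowr (\<Sum>\<^sub>\<infinity>Q\<in>D. ennreal ((f Q x)\<^sup>2) * indicator Q x) (1 / 2)"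

text \<open>
  Best constants are infima over \<open>[0,\<infinity>]\<close>. The convention \<open>0 * \<infinity> = 0\<close> of \<^typ>\<open>ennreal\<close> does not
  affect their values: a vanishing right-hand norm forces a vanishing left-hand norm, and
  a candidate \<open>C = 0\<close> does not matter for the infimum if all \<open>C > 0\<close> are admissible.
\<close>

definition quadratic_A_const ::
    "nat \<Rightarrow> (int \<Rightarrow> (nat \<Rightarrow> real) set set) \<Rightarrow> real \<Rightarrow> real \<Rightarrow>
     (nat \<Rightarrow> real) measure \<Rightarrow> (nat \<Rightarrow> real) measure \<Rightarrow> ennreal" where
  "quadratic_A_const N \<D> p q \<sigma> w =
     Inf {C. \<forall>a :: (nat \<Rightarrow> real) set \<Rightarrow> real.
       Lp_norm q w (square_function (\<Union>k. \<D> k)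
         (\<lambda>Q _. a Q * (measure \<sigma> Q / measure (Rn_lebesgue N) Q)))
       \<le> C * Lp_norm p \<sigma> (square_function (\<Union>k. \<D> k) (\<lambda>Q _. a Q))}"

definition averaging_const ::
    "nat \<Rightarrow> (int \<Rightarrow> (nat \<Rightarrow> real) set set) \<Rightarrow> real \<Rightarrow> real \<Rightarrow>
     (nat \<Rightarrow> real) measure \<Rightarrow> (nat \<Rightarrow> real) measure \<Rightarrow> ennreal" where
  "averaging_const N \<D> p q \<sigma> w =
     Inf {C. \<forall>f :: (nat \<Rightarrow> real) set \<Rightarrow> (nat \<Rightarrow> real) \<Rightarrow> real.
       (\<forall>Q\<in>(\<Union>k. \<D> k). locally_integrable N \<sigma> (f Q)) \<longrightarrow>
       Lp_norm q w (square_function (\<Union>k. \<D> k)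
         (\<lambda>Q _. (LINT y:Q|\<sigma>. f Q y) / measure (Rn_lebesgue N) Q))
       \<le> C * Lp_norm p \<sigma> (square_function (\<Union>k. \<D> k) f)}"

end

theory Submission
  imports Defs
begin

text \<open>
  Constant functions \<open>f\<^sub>Q = a\<^sub>Q\<close> show that the averaging constant dominates the quadratic constant.
  Conversely, \<open>\<integral>\<^sub>Q f\<^sub>Q d\<sigma> = a\<^sub>Q \<sigma>(Q)\<close> for the \<open>\<sigma>\<close>-average \<open>a\<^sub>Q\<close> of \<open>f\<^sub>Q\<close>, so the left-hand sides of the
  two inequalities agree and it remains to compare the right-hand sides: the square function of the
  averages \<open>a\<^sub>Q\<close> must be bounded in \<open>L\<^sup>p(\<sigma>)\<close> by the square function of the \<open>f\<^sub>Q\<close>. This is Stein's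
  inequality for conditional expectations (\<open>stein_inequality\<close>). It is proved here for every measure
  and every countable nested family of measurable sets of finite measure, with the explicit
  constant \<open>K = max 1 (p/2) (max 1 (1/(p-1)))\<^sup>1\<^sup>/\<^sup>2\<close>, which depends on \<open>p\<close> alone.

  The proof of Stein's inequality is direct, by telescoping. Let the family be finite, let
  \<open>S\<^sup>2 = \<Sum>\<^sub>Q a\<^sub>Q\<^sup>2 1\<^sub>Q\<close> and \<open>F\<^sup>2 = \<Sum>\<^sub>Q f\<^sub>Q\<^sup>2 1\<^sub>Q\<close>, and let \<open>A\<^sub>Q\<close> be the sum of \<open>a\<^sub>R\<^sup>2\<close> over all \<open>R \<supseteq> Q\<close>. The
  sets that contain a given point form a chain, and \<open>A\<close> runs through the partial sums of \<open>S\<^sup>2\<close> along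
  it. Telescoping (\<open>chain_powr_sum\<close>) gives
    \<open>S\<^sup>p \<le> max 1 (p/2) \<Sum>\<^sub>Q a\<^sub>Q\<^sup>2 A\<^sub>Q\<^bsup>p/2-1\<^esup> 1\<^sub>Q\<close>.
  The coefficients on the right are constants, so after integration one of the two factors \<open>a\<^sub>Q\<close> can
  be replaced by \<open>\<bar>f\<^sub>Q\<bar>\<close>. By Cauchy-Schwarz and a second telescoping, with exponent \<open>p - 1\<close>, the new
  integrand, times \<open>max 1 (p/2)\<close>, is at most \<open>K F S\<^bsup>p-1\<^esup>\<close>, and by Young's inequality at most
  \<open>K\<^sup>p F\<^sup>p / p + (1 - 1/p) S\<^sup>p\<close>. The integral of \<open>S\<^sup>p\<close> is finite and can be absorbed.
  Monotone convergence extends the result to countable families.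
\<close>

section \<open>Telescoping powers along a chain of sets\<close>

text \<open>
  For \<open>s > 1\<close> this is Bernoulli's inequality, obtained from the weighted inequality between the
  geometric and the arithmetic mean of \<open>t\<^sup>s\<close> and \<open>1\<close>.
\<close>

lemma one_minus_powr_le:
  fixes s t :: real
  assumes "0 < s" "0 \<le> t" "t \<le> 1"
  shows "1 - t powr s \<le> max 1 s * (1 - t)"
proof (cases "t = 0 \<or> s \<le> 1")
  case True
  have "t \<le> t powr s" if "s \<le> 1" "0 < t"
    using powr_mono'[of s 1 t] that assms by simp
  with True assms show ?thesis
    by (cases "t = 0") (auto simp: max_def)
next
  case False
  hence s: "s > 1" and t: "t > 0" using assms by auto
  have "(t powr s) powr (1 / s) * 1 powr (1 - 1 / s) \<le> 1 / s * t powr s + (1 - 1 / s) * 1"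
    by (rule Youngs_inequality_0) (use s t in auto)
  moreover have "(t powr s) powr (1 / s) = t"
    using s t by (simp add: powr_powr)
  ultimately have "t \<le> 1 / s * t powr s + (1 - 1 / s)" by simp
  hence "s * t \<le> s * (1 / s * t powr s + (1 - 1 / s))"
    by (rule mult_left_mono) (use s in simp)
  also have "\<dots> = t powr s + s - 1" using s by (simp add: field_simps)
  finally show ?thesis using s by (simp add: max_def algebra_simps)
qed

text \<open>
  Up to a constant factor, \<open>x\<^sup>s - y\<^sup>s\<close> is at most the length \<open>x - y\<close> times the derivative at the right
  endpoint, and conversely. By homogeneity only \<open>t = y / x\<close> matters, and the second estimate is the
  preceding lemma for \<open>t\<^sup>s\<close> and the exponent \<open>1 / s\<close>.
\<close>

lemma powr_diff_le:
  fixes s x y :: real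
  assumes "0 < s" "0 \<le> y" "y \<le> x"
  shows "x powr s - y powr s \<le> max 1 s * ((x - y) * x powr (s - 1))"
    and "(x - y) * x powr (s - 1) \<le> max 1 (1 / s) * (x powr s - y powr s)"
proof -
  consider "x = 0" | "x > 0" using assms by linarith
  then have "x powr s - y powr s \<le> max 1 s * ((x - y) * x powr (s - 1)) \<and>
    (x - y) * x powr (s - 1) \<le> max 1 (1 / s) * (x powr s - y powr s)"
  proof cases
    case 1
    thus ?thesis using assms by simp
  next
    case 2
    define t where "t = y / x"
    have t: "0 \<le> t" "t \<le> 1" and y: "y = t * x" using assms 2 by (auto simp: t_def)
    have x: "x powr (s - 1) * x = x powr s" using 2 by (simp add: powr_diff)
    have ts: "t powr s \<le> 1" using t assms powr_mono2[of s t 1] by simp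
    have e1: "x powr s - y powr s = x powr s * (1 - t powr s)"
      using t 2 by (simp add: y powr_mult algebra_simps)
    have e2: "(x - y) * x powr (s - 1) = x powr s * (1 - t)"
      by (simp add: y x[symmetric] algebra_simps)
    have i1: "1 - t powr s \<le> max 1 s * (1 - t)"
      by (rule one_minus_powr_le) (use assms t in auto)
    have "1 - (t powr s) powr (1 / s) \<le> max 1 (1 / s) * (1 - t powr s)"
      by (rule one_minus_powr_le) (use assms ts in auto)
    hence i2: "1 - t \<le> max 1 (1 / s) * (1 - t powr s)"
      using assms t by (simp add: powr_powr)
    show ?thesis unfolding e1 e2
      using mult_left_mono[OF i1, of "x powr s"] mult_left_mono[OF i2, of "x powr s"]
      by (simp add: mult_ac)
  qed
  thus "x powr s - y powr s \<le> max 1 s * ((x - y) * x powr (s - 1))"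
    and "(x - y) * x powr (s - 1) \<le> max 1 (1 / s) * (x powr s - y powr s)" by auto
qed

definition sum_above :: "'a set set \<Rightarrow> ('a set \<Rightarrow> real) \<Rightarrow> 'a set \<Rightarrow> real" where
  "sum_above G b Q = (\<Sum>R\<in>{R\<in>G. Q \<subseteq> R}. b R)"

text \<open>
  Listing the chain from the largest set to the smallest turns \<open>sum_above C b Q\<close> into the partial sum
  that ends with \<open>Q\<close>, and subtracting \<open>b Q\<close> gives the preceding partial sum. The induction removes
  the smallest set, which lies above no other set and so leaves the other partial sums unchanged.
\<close>

lemma chain_telescope:
  fixes b :: "'a set \<Rightarrow> real" and \<phi> :: "real \<Rightarrow> real"
  assumes "finite C" and "\<And>Q R. Q \<in> C \<Longrightarrow> R \<in> C \<Longrightarrow> Q \<subseteq> R \<or> R \<subseteq> Q"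
  shows "(\<Sum>Q\<in>C. \<phi> (sum_above C b Q) - \<phi> (sum_above C b Q - b Q)) = \<phi> (sum b C) - \<phi> 0"
  using assms
proof (induction "card C" arbitrary: C)
  case 0
  thus ?case by simp
next
  case (Suc n)
  then obtain m where m: "m \<in> C" "\<And>Q. Q \<in> C \<Longrightarrow> Q \<subseteq> m \<Longrightarrow> m = Q"
    using finite_has_minimal[of C] by (metis card.empty nat.distinct(1))
  have least: "m \<subseteq> Q" if "Q \<in> C" for Q
    using Suc.prems(2)[OF m(1) that] m(2)[OF that] by blast
  define C' where "C' = C - {m}"
  have C: "C = insert m C'" "m \<notin> C'" "finite C'" using m Suc.prems by (auto simp: C'_def)
  have above: "sum_above C b Q = sum_above C' b Q" if "Q \<in> C'" for Q
  proof -
    have "{R \<in> C. Q \<subseteq> R} = {R \<in> C'. Q \<subseteq> R}"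
      using that m(2) C by auto
    thus ?thesis by (simp add: sum_above_def)
  qed
  have am: "sum_above C b m = sum b C"
    unfolding sum_above_def by (rule sum.cong) (use least in auto)
  have "(\<Sum>Q\<in>C'. \<phi> (sum_above C' b Q) - \<phi> (sum_above C' b Q - b Q)) = \<phi> (sum b C') - \<phi> 0"
    by (rule Suc.hyps(1)) (use Suc.prems Suc.hyps(2) C in auto)
  moreover have "(\<Sum>Q\<in>C. \<phi> (sum_above C b Q) - \<phi> (sum_above C b Q - b Q))
     = \<phi> (sum b C) - \<phi> (sum b C - b m)
       + (\<Sum>Q\<in>C'. \<phi> (sum_above C' b Q) - \<phi> (sum_above C' b Q - b Q))"
  proof -
    have "(\<Sum>Q\<in>C'. \<phi> (sum_above C b Q) - \<phi> (sum_above C b Q - b Q))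
        = (\<Sum>Q\<in>C'. \<phi> (sum_above C' b Q) - \<phi> (sum_above C' b Q - b Q))"
      by (rule sum.cong) (simp_all add: above)
    thus ?thesis
      using sum.remove[OF Suc.prems(1) m(1), of "\<lambda>Q. \<phi> (sum_above C b Q) - \<phi> (sum_above C b Q - b Q)"]
      by (simp add: am C'_def)
  qed
  moreover have "sum b C - b m = sum b C'"
    using C by simp
  ultimately show ?case by simp
qed

text \<open>
  Discrete forms of \<open>\<integral> x\<^bsup>s-1\<^esup> dx = x\<^sup>s / s\<close>: each increment of the telescoping sum is estimated from
  above and from below by \<open>powr_diff_le\<close>.
\<close>

lemma chain_powr_sum:
  fixes b :: "'a set \<Rightarrow> real"
  assumes "finite C" and "\<And>Q R. Q \<in> C \<Longrightarrow> R \<in> C \<Longrightarrow> Q \<subseteq> R \<or> R \<subseteq> Q"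
    and b: "\<And>Q. 0 \<le> b Q" and s: "0 < s"
  shows "sum b C powr s \<le> max 1 s * (\<Sum>Q\<in>C. b Q * sum_above C b Q powr (s - 1))"
    and "(\<Sum>Q\<in>C. b Q * sum_above C b Q powr (s - 1)) \<le> max 1 (1 / s) * sum b C powr s"
proof -
  have le: "0 \<le> sum_above C b Q - b Q" if "Q \<in> C" for Q
  proof -
    have "sum b {Q} \<le> sum_above C b Q" unfolding sum_above_def
      by (rule sum_mono2) (use that assms in auto)
    thus ?thesis by simp
  qed
  have tel: "(\<Sum>Q\<in>C. sum_above C b Q powr s - (sum_above C b Q - b Q) powr s) = sum b C powr s"
    using chain_telescope[OF assms(1,2), of "\<lambda>x. x powr s" b] s by simp
  show "sum b C powr s \<le> max 1 s * (\<Sum>Q\<in>C. b Q * sum_above C b Q powr (s - 1))"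
    unfolding tel[symmetric] sum_distrib_left
  proof (rule sum_mono)
    fix Q assume Q: "Q \<in> C"
    show "sum_above C b Q powr s - (sum_above C b Q - b Q) powr s
      \<le> max 1 s * (b Q * sum_above C b Q powr (s - 1))"
      using powr_diff_le(1)[OF s le[OF Q], of "sum_above C b Q"] b[of Q] by simp
  qed
  show "(\<Sum>Q\<in>C. b Q * sum_above C b Q powr (s - 1)) \<le> max 1 (1 / s) * sum b C powr s"
    unfolding tel[symmetric] sum_distrib_left
  proof (rule sum_mono)
    fix Q assume Q: "Q \<in> C"
    show "b Q * sum_above C b Q powr (s - 1)
      \<le> max 1 (1 / s) * (sum_above C b Q powr s - (sum_above C b Q - b Q) powr s)"
      using powr_diff_le(2)[OF s le[OF Q], of "sum_above C b Q"] b[of Q] by simp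
  qed
qed

text \<open>
  Cauchy-Schwarz leaves the sum of \<open>(a Q)\<^sup>2 (A Q)\<^bsup>p-2\<^esup>\<close>, which telescopes with the exponent
  \<open>s = p - 1\<close>. Positivity of this exponent is the point where \<open>p > 1\<close> enters.
\<close>

lemma chain_cross_sum:
  fixes a g :: "'a set \<Rightarrow> real"
  assumes "finite C" and "\<And>Q R. Q \<in> C \<Longrightarrow> R \<in> C \<Longrightarrow> Q \<subseteq> R \<or> R \<subseteq> Q" and p: "1 < p"
  defines "A \<equiv> sum_above C (\<lambda>Q. (a Q)\<^sup>2)"
  shows "(\<Sum>Q\<in>C. \<bar>a Q\<bar> * A Q powr (p / 2 - 1) * \<bar>g Q\<bar>)
    \<le> sqrt (max 1 (1 / (p - 1))) * (sqrt (\<Sum>Q\<in>C. (g Q)\<^sup>2) * (\<Sum>Q\<in>C. (a Q)\<^sup>2) powr ((p - 1) / 2))"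
proof -
  let ?T = "\<Sum>Q\<in>C. (a Q)\<^sup>2"
  have T: "0 \<le> ?T" by (simp add: sum_nonneg)
  have sq: "(\<bar>a Q\<bar> * A Q powr (p / 2 - 1))\<^sup>2 = (a Q)\<^sup>2 * A Q powr (p - 1 - 1)" for Q
  proof -
    have "(A Q powr (p / 2 - 1))\<^sup>2 = A Q powr (p - 1 - 1)"
      by (simp add: power2_eq_square powr_add[symmetric])
    thus ?thesis by (simp only: power_mult_distrib power2_abs)
  qed
  have "(\<Sum>Q\<in>C. (\<bar>a Q\<bar> * A Q powr (p / 2 - 1)) * \<bar>g Q\<bar>)\<^sup>2
      \<le> (\<Sum>Q\<in>C. (\<bar>a Q\<bar> * A Q powr (p / 2 - 1))\<^sup>2) * (\<Sum>Q\<in>C. \<bar>g Q\<bar>\<^sup>2)"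
    by (rule Cauchy_Schwarz_ineq_sum)
  also have "\<dots> = (\<Sum>Q\<in>C. (a Q)\<^sup>2 * A Q powr (p - 1 - 1)) * (\<Sum>Q\<in>C. (g Q)\<^sup>2)"
    by (simp only: sq power2_abs)
  also have "\<dots> \<le> (max 1 (1 / (p - 1)) * ?T powr (p - 1)) * (\<Sum>Q\<in>C. (g Q)\<^sup>2)"
    unfolding A_def
    by (intro mult_right_mono chain_powr_sum(2)[OF assms(1,2)]) (use p in \<open>auto simp: sum_nonneg\<close>)
  also have "?T powr (p - 1) = (?T powr ((p - 1) / 2))\<^sup>2"
    by (simp add: power2_eq_square powr_add[symmetric])
  finally have "(\<Sum>Q\<in>C. \<bar>a Q\<bar> * A Q powr (p / 2 - 1) * \<bar>g Q\<bar>)\<^sup>2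
      \<le> max 1 (1 / (p - 1)) * (?T powr ((p - 1) / 2))\<^sup>2 * (\<Sum>Q\<in>C. (g Q)\<^sup>2)" .
  hence "(\<Sum>Q\<in>C. \<bar>a Q\<bar> * A Q powr (p / 2 - 1) * \<bar>g Q\<bar>)
      \<le> sqrt (max 1 (1 / (p - 1)) * (?T powr ((p - 1) / 2))\<^sup>2 * (\<Sum>Q\<in>C. (g Q)\<^sup>2))"
    by (rule real_le_rsqrt)
  also have "\<dots> = sqrt (max 1 (1 / (p - 1))) * (?T powr ((p - 1) / 2) * sqrt (\<Sum>Q\<in>C. (g Q)\<^sup>2))"
    by (simp only: real_sqrt_mult real_sqrt_abs mult.assoc) simp
  finally show ?thesis by (simp only: mult.commute)
qed

lemma Young_powr:
  fixes u v p :: real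
  assumes "1 < p" "0 \<le> u" "0 \<le> v"
  shows "u * v powr (p - 1) \<le> 1 / p * u powr p + (1 - 1 / p) * v powr p"
proof -
  have "u * v powr (p - 1) \<le> u powr p / p + (v powr (p - 1)) powr (p / (p - 1)) / (p / (p - 1))"
    by (rule Youngs_inequality) (use assms in \<open>auto simp: field_simps\<close>)
  also have "(v powr (p - 1)) powr (p / (p - 1)) = v powr p"
    using assms by (simp add: powr_powr)
  finally show ?thesis using assms by (simp add: field_simps)
qed

section \<open>Stein's inequality for nested families\<close>

definition stein_const :: "real \<Rightarrow> real" where
  "stein_const p = max 1 (p / 2) * sqrt (max 1 (1 / (p - 1)))"

lemma stein_const_pos: "0 < stein_const p"
  unfolding stein_const_def by (intro mult_pos_pos) (auto simp: less_max_iff_disj)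

text \<open>
  The averages enter only through \<open>\<bar>a Q\<bar> * measure M Q \<le> \<integral>\<^sub>Q \<bar>f Q\<bar>\<close>, which converts the integral of \<open>L\<close>,
  with two factors \<open>a Q\<close>, into that of \<open>H\<close>, with one. Finiteness of the family makes \<open>L\<close> integrable,
  so the integral \<open>X\<close> of the left-hand side is finite and can be absorbed.
\<close>

lemma stein_inequality_finite:
  fixes f :: "'a set \<Rightarrow> 'a \<Rightarrow> real"
  assumes p: "1 < p" and G: "finite G" "G \<subseteq> sets M"
    and nested: "\<And>Q R. Q \<in> G \<Longrightarrow> R \<in> G \<Longrightarrow> Q \<subseteq> R \<or> R \<subseteq> Q \<or> Q \<inter> R = {}"
    and fin: "\<And>Q. Q \<in> G \<Longrightarrow> emeasure M Q < \<infinity>"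
    and int: "\<And>Q. Q \<in> G \<Longrightarrow> set_integrable M Q (f Q)"
  defines "a \<equiv> \<lambda>Q. (LINT y:Q|M. f Q y) / measure M Q"
  shows "(\<integral>\<^sup>+x. ennreal ((\<Sum>Q\<in>G. (a Q)\<^sup>2 * indicator Q x) powr (p / 2)) \<partial>M)
    \<le> ennreal (stein_const p powr p) *
       (\<integral>\<^sup>+x. ennreal ((\<Sum>Q\<in>G. (f Q x)\<^sup>2 * indicator Q x) powr (p / 2)) \<partial>M)"
proof -
  define A where "A = sum_above G (\<lambda>Q. (a Q)\<^sup>2)"
  define T where "T x = (\<Sum>Q\<in>G. (a Q)\<^sup>2 * indicator Q x)" for x
  define U where "U x = (\<Sum>Q\<in>G. (f Q x)\<^sup>2 * indicator Q x)" for x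
  define L where "L x = (\<Sum>Q\<in>G. (a Q)\<^sup>2 * A Q powr (p / 2 - 1) * indicator Q x)" for x
  define H where "H x = (\<Sum>Q\<in>G. \<bar>a Q\<bar> * A Q powr (p / 2 - 1) * (\<bar>f Q x\<bar> * indicator Q x))" for x
  define K1 where "K1 = max 1 (p / 2)"
  define K2 where "K2 = sqrt (max 1 (1 / (p - 1)))"
  have K: "stein_const p = K1 * K2" "0 < K1" "0 < K2"
    by (auto simp: stein_const_def K1_def K2_def less_max_iff_disj)
  have nn: "0 \<le> T x" "0 \<le> U x" "0 \<le> L x" "0 \<le> H x" for x
    by (auto simp: T_def U_def L_def H_def intro!: sum_nonneg)
  \<comment> \<open>At a fixed point only the sets containing it matter; they form a chain, and every superset of
    one of them is again among them, so \<open>A\<close> agrees with the partial sums along this chain.\<close>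
  have pt: "T x powr (p / 2) \<le> K1 * L x \<and> H x \<le> K2 * (sqrt (U x) * T x powr ((p - 1) / 2))" for x
  proof -
    define C where "C = {Q \<in> G. x \<in> Q}"
    have C: "finite C" using G by (simp add: C_def)
    have chain: "Q \<subseteq> R \<or> R \<subseteq> Q" if "Q \<in> C" "R \<in> C" for Q R
      using nested[of Q R] that by (auto simp: C_def)
    have restr: "(\<Sum>Q\<in>G. h Q * indicator Q x) = sum h C" for h :: "'a set \<Rightarrow> real"
      unfolding C_def using G by (auto simp: indicator_def intro!: sum.mono_neutral_cong_right)
    have A: "A Q = sum_above C (\<lambda>Q. (a Q)\<^sup>2) Q" if "Q \<in> C" for Q
      unfolding A_def sum_above_def by (rule sum.cong) (use that in \<open>auto simp: C_def\<close>)
    have T: "T x = (\<Sum>Q\<in>C. (a Q)\<^sup>2)" and U: "U x = (\<Sum>Q\<in>C. (f Q x)\<^sup>2)"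
      by (simp_all add: T_def U_def restr)
    have L: "L x = (\<Sum>Q\<in>C. (a Q)\<^sup>2 * sum_above C (\<lambda>Q. (a Q)\<^sup>2) Q powr (p / 2 - 1))"
      unfolding L_def restr by (rule sum.cong) (simp_all add: A)
    have H: "H x = (\<Sum>Q\<in>C. \<bar>a Q\<bar> * sum_above C (\<lambda>Q. (a Q)\<^sup>2) Q powr (p / 2 - 1) * \<bar>f Q x\<bar>)"
      unfolding H_def mult.assoc[symmetric] restr by (rule sum.cong) (simp_all add: A)
    show ?thesis unfolding L H T U K1_def K2_def
      using chain_powr_sum(1)[OF C chain, of "\<lambda>Q. (a Q)\<^sup>2" "p / 2"]
        chain_cross_sum[OF C chain p, of a "\<lambda>Q. f Q x"] p by simp
  qed
  have iabs: "integrable M (\<lambda>x. \<bar>f Q x\<bar> * indicator Q x)" if "Q \<in> G" for Q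
    using integrable_abs[OF int[OF that, unfolded set_integrable_def]]
    by (simp add: abs_mult mult.commute)
  have iind: "integrable M (indicator Q :: 'a \<Rightarrow> real)" if "Q \<in> G" for Q
    using that G fin by (intro integrable_real_indicator) auto
  have iL: "integrable M L" and iH: "integrable M H"
    unfolding L_def H_def by (intro Bochner_Integration.integrable_sum integrable_mult_right iind iabs; assumption)+
  have "integral\<^sup>L M L = (\<Sum>Q\<in>G. (a Q)\<^sup>2 * A Q powr (p / 2 - 1) * measure M Q)"
  proof -
    have "integral\<^sup>L M (indicator Q :: 'a \<Rightarrow> real) = measure M Q" if "Q \<in> G" for Q
      using that G sets.Int_space_eq2[of Q M] by auto
    moreover have "integral\<^sup>L M L = (\<Sum>Q\<in>G. (a Q)\<^sup>2 * A Q powr (p / 2 - 1) * integral\<^sup>L M (indicator Q))"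
      unfolding L_def by (subst Bochner_Integration.integral_sum) (simp_all add: iind)
    ultimately show ?thesis by simp
  qed
  also have "\<dots> \<le> (\<Sum>Q\<in>G. \<bar>a Q\<bar> * A Q powr (p / 2 - 1) * (\<integral>x. \<bar>f Q x\<bar> * indicator Q x \<partial>M))"
  proof (rule sum_mono)
    fix Q assume Q: "Q \<in> G"
    have "\<bar>a Q\<bar> * measure M Q \<le> \<bar>LINT y:Q|M. f Q y\<bar>"
      by (simp add: a_def)
    also have "\<dots> \<le> (\<integral>x. \<bar>f Q x\<bar> * indicator Q x \<partial>M)"
      unfolding set_lebesgue_integral_def
      using integral_abs_bound[of M "\<lambda>x. indicator Q x *\<^sub>R f Q x"] by (simp add: abs_mult mult.commute)
    finally have "\<bar>a Q\<bar> * A Q powr (p / 2 - 1) * (\<bar>a Q\<bar> * measure M Q)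
       \<le> \<bar>a Q\<bar> * A Q powr (p / 2 - 1) * (\<integral>x. \<bar>f Q x\<bar> * indicator Q x \<partial>M)"
      by (rule mult_left_mono) simp
    moreover have "(a Q)\<^sup>2 = \<bar>a Q\<bar> * \<bar>a Q\<bar>" by (simp add: power2_eq_square)
    ultimately show "(a Q)\<^sup>2 * A Q powr (p / 2 - 1) * measure M Q
       \<le> \<bar>a Q\<bar> * A Q powr (p / 2 - 1) * (\<integral>x. \<bar>f Q x\<bar> * indicator Q x \<partial>M)"
      by (simp only: mult_ac)
  qed
  also have "\<dots> = integral\<^sup>L M H"
    unfolding H_def by (subst Bochner_Integration.integral_sum) (simp_all add: iabs)
  finally have LH: "integral\<^sup>L M L \<le> integral\<^sup>L M H" .
  \<comment> \<open>Young's inequality with exactly these weights makes the final constant \<open>stein_const p\<close>: after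
    the fraction \<open>1 - 1 / p\<close> of \<open>X\<close> is absorbed, both sides carry the factor \<open>1 / p\<close>.\<close>
  have young: "K1 * H x \<le> 1 / p * (stein_const p powr p * U x powr (p / 2)) + (1 - 1 / p) * T x powr (p / 2)" for x
  proof -
    have "K1 * H x \<le> K1 * (K2 * (sqrt (U x) * T x powr ((p - 1) / 2)))"
      using pt[of x] K by (intro mult_left_mono) auto
    also have "\<dots> = (stein_const p * sqrt (U x)) * sqrt (T x) powr (p - 1)"
      using nn[of x] by (simp add: K powr_half_sqrt[symmetric] powr_powr)
    also have "\<dots> \<le> 1 / p * (stein_const p * sqrt (U x)) powr p + (1 - 1 / p) * sqrt (T x) powr p"
      by (rule Young_powr) (use p nn stein_const_pos[of p] in auto)
    also have "(stein_const p * sqrt (U x)) powr p = stein_const p powr p * U x powr (p / 2)"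
      using nn[of x] stein_const_pos[of p] by (simp add: powr_mult powr_half_sqrt[symmetric] powr_powr)
    also have "sqrt (T x) powr p = T x powr (p / 2)"
      using nn[of x] by (simp add: powr_half_sqrt[symmetric] powr_powr)
    finally show ?thesis .
  qed
  define X where "X = (\<integral>\<^sup>+x. ennreal (T x powr (p / 2)) \<partial>M)"
  define Y where "Y = (\<integral>\<^sup>+x. ennreal (U x powr (p / 2)) \<partial>M)"
  have [measurable]: "T \<in> borel_measurable M"
    unfolding T_def using G by (intro borel_measurable_sum borel_measurable_times) auto
  have "(\<lambda>x. (f Q x)\<^sup>2 * indicator Q x) \<in> borel_measurable M" if "Q \<in> G" for Q
  proof -
    have "(\<lambda>x. (indicator Q x *\<^sub>R f Q x)\<^sup>2) \<in> borel_measurable M"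
      using int[OF that] unfolding set_integrable_def by (intro borel_measurable_power) auto
    also have "(\<lambda>x. (indicator Q x *\<^sub>R f Q x)\<^sup>2) = (\<lambda>x. (f Q x)\<^sup>2 * indicator Q x)"
      by (auto simp: indicator_def)
    finally show ?thesis .
  qed
  hence [measurable]: "U \<in> borel_measurable M"
    unfolding U_def by (intro borel_measurable_sum) auto
  have "X \<le> (\<integral>\<^sup>+x. ennreal (K1 * L x) \<partial>M)"
    unfolding X_def using pt by (intro nn_integral_mono ennreal_leI) auto
  also have eL: "\<dots> = ennreal (K1 * integral\<^sup>L M L)"
    using iL nn K by (subst nn_integral_eq_integral) auto
  finally have X1: "X \<le> ennreal (K1 * integral\<^sup>L M L)" .
  hence Xfin: "X \<noteq> \<infinity>" by (auto simp: top_unique)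
  note X1
  also have "ennreal (K1 * integral\<^sup>L M L) \<le> ennreal (K1 * integral\<^sup>L M H)"
    using LH K by (intro ennreal_leI mult_left_mono) auto
  also have "\<dots> = (\<integral>\<^sup>+x. ennreal (K1 * H x) \<partial>M)"
    using iH nn K by (subst nn_integral_eq_integral) auto
  also have "\<dots> \<le> (\<integral>\<^sup>+x. ennreal (1 / p * stein_const p powr p) * ennreal (U x powr (p / 2))
       + ennreal (1 - 1 / p) * ennreal (T x powr (p / 2)) \<partial>M)"
  proof (rule nn_integral_mono)
    fix x
    have "ennreal (K1 * H x) \<le> ennreal (1 / p * (stein_const p powr p * U x powr (p / 2)) + (1 - 1 / p) * T x powr (p / 2))"
      by (rule ennreal_leI[OF young])
    thus "ennreal (K1 * H x) \<le> ennreal (1 / p * stein_const p powr p) * ennreal (U x powr (p / 2))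
       + ennreal (1 - 1 / p) * ennreal (T x powr (p / 2))"
      using p by (simp add: ennreal_mult'[symmetric] ennreal_plus[symmetric] mult.assoc del: ennreal_plus)
  qed
  also have "\<dots> = ennreal (1 / p * stein_const p powr p) * Y + ennreal (1 - 1 / p) * X"
    unfolding X_def Y_def by (simp add: nn_integral_add nn_integral_cmult)
  finally have main: "X \<le> ennreal (1 / p * stein_const p powr p) * Y + ennreal (1 - 1 / p) * X" .
  have "X \<le> ennreal (stein_const p powr p) * Y"
  proof (cases "Y = \<infinity>")
    case True
    thus ?thesis using stein_const_pos[of p] by (simp add: ennreal_mult_top)
  next
    case False
    then obtain x y where xy: "X = ennreal x" "Y = ennreal y" "0 \<le> x" "0 \<le> y"
      using Xfin by (metis ennreal_cases infinity_ennreal_def)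
    have "x \<le> 1 / p * stein_const p powr p * y + (1 - 1 / p) * x"
      using main xy p by (simp add: ennreal_mult'[symmetric] ennreal_plus[symmetric] del: ennreal_plus)
    hence "x \<le> stein_const p powr p * y" using p by (simp add: field_simps)
    thus ?thesis using xy by (simp add: ennreal_mult'[symmetric])
  qed
  thus ?thesis unfolding X_def Y_def T_def U_def .
qed

subsection \<open>Powers on the extended half-line\<close>

lemma ennpowr_ennreal: "0 \<le> t \<Longrightarrow> ennpowr (ennreal t) r = ennreal (t powr r)"
  by (simp add: ennpowr_def)

lemma ennpowr_top: "ennpowr \<infinity> r = \<infinity>"
  by (simp add: ennpowr_def)

lemma ennreal_infinity_cases:
  obtains "t = \<infinity>" | x where "0 \<le> x" "t = ennreal x"
  by (metis ennreal_cases infinity_ennreal_def)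

lemma ennpowr_ennpowr: "ennpowr (ennpowr t r) s = ennpowr t (r * s)"
  by (cases t rule: ennreal_infinity_cases) (simp_all add: ennpowr_ennreal ennpowr_top powr_powr del: infinity_ennreal_def)

lemma ennpowr_one: "ennpowr t 1 = t"
  by (cases t rule: ennreal_infinity_cases) (simp_all add: ennpowr_ennreal ennpowr_top del: infinity_ennreal_def)

lemma ennpowr_mono:
  assumes "0 < r" "s \<le> t"
  shows "ennpowr s r \<le> ennpowr t r"
proof (cases t rule: ennreal_infinity_cases)
  case 1
  thus ?thesis by (simp add: ennpowr_def)
next
  case (2 y)
  with assms(2) obtain x where x: "0 \<le> x" "s = ennreal x"
    by (cases s rule: ennreal_infinity_cases) (auto simp: top_unique)
  hence "x \<le> y" using 2 assms by simp
  thus ?thesis using x 2 assms(1) by (simp add: ennpowr_ennreal powr_mono2)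
qed

text \<open>
  A power with positive exponent is an order isomorphism of \<open>[0,\<infinity>]\<close> whose inverse is the power with
  the reciprocal exponent; hence it commutes with suprema.
\<close>

lemma ennpowr_le_iff:
  assumes "0 < r"
  shows "ennpowr t r \<le> u \<longleftrightarrow> t \<le> ennpowr u (1 / r)"
  using ennpowr_mono[OF assms, of t "ennpowr u (1 / r)"] ennpowr_mono[of "1 / r" "ennpowr t r" u] assms
  by (auto simp: ennpowr_ennpowr ennpowr_one)

lemma ennpowr_SUP:
  assumes "0 < r"
  shows "ennpowr (SUP i\<in>I. u i) r = (SUP i\<in>I. ennpowr (u i) r)"
proof (rule antisym)
  show "ennpowr (SUP i\<in>I. u i) r \<le> (SUP i\<in>I. ennpowr (u i) r)"
    unfolding ennpowr_le_iff[OF assms]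
    by (rule SUP_least, subst ennpowr_le_iff[OF assms, symmetric]) (rule SUP_upper)
  show "(SUP i\<in>I. ennpowr (u i) r) \<le> ennpowr (SUP i\<in>I. u i) r"
    by (intro SUP_least ennpowr_mono assms SUP_upper)
qed

lemma ennpowr_cmult:
  assumes "0 < c"
  shows "ennpowr (ennreal c * t) r = ennreal (c powr r) * ennpowr t r"
proof (cases t rule: ennreal_infinity_cases)
  case 1
  thus ?thesis using assms by (simp add: ennpowr_def ennreal_mult_top)
next
  case (2 x)
  thus ?thesis using assms
    by (simp add: ennreal_mult'[symmetric] ennpowr_ennreal powr_mult)
qed

subsection \<open>From finite to countable families\<close>

lemma finite_initial_segment:
  assumes "countable D"
  shows "finite {Q\<in>D. to_nat_on D Q < n}"
  by (rule inj_on_finite[of "to_nat_on D" _ "{..<n}"])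
    (use inj_on_to_nat_on[OF assms] in \<open>auto intro: inj_on_subset\<close>)

text \<open>
  Along an enumeration the sum becomes the supremum of a sequence rather than of a directed family,
  as monotone convergence requires.
\<close>

lemma ennreal_infsum_eq_SUP:
  fixes h :: "'a \<Rightarrow> ennreal"
  assumes "countable D"
  shows "infsum h D = (SUP n. sum h {Q\<in>D. to_nat_on D Q < n})"
proof (rule antisym)
  note fin = finite_initial_segment[OF assms]
  have eq: "infsum h D = (SUP F\<in>{F. finite F \<and> F \<subseteq> D}. sum h F)"
    by (rule nonneg_infsum_complete) simp
  show "infsum h D \<le> (SUP n. sum h {Q\<in>D. to_nat_on D Q < n})"
    unfolding eq
  proof (rule SUP_least)
    fix F assume F: "F \<in> {F. finite F \<and> F \<subseteq> D}"
    then obtain n where "\<forall>i\<in>to_nat_on D ` F. i < n"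
      using finite_nat_set_iff_bounded[of "to_nat_on D ` F"] by auto
    with F have "sum h F \<le> sum h {Q\<in>D. to_nat_on D Q < n}"
      by (intro sum_mono2 fin) auto
    also have "\<dots> \<le> (SUP n. sum h {Q\<in>D. to_nat_on D Q < n})"
      by (rule SUP_upper) simp
    finally show "sum h F \<le> (SUP n. sum h {Q\<in>D. to_nat_on D Q < n})" .
  qed
  show "(SUP n. sum h {Q\<in>D. to_nat_on D Q < n}) \<le> infsum h D"
    unfolding eq by (rule SUP_mono) (use fin in auto)
qed

text \<open>
  The finite subfamilies of an enumeration satisfy the inequality with the same constant. Monotone
  convergence applies to the square function of the averages on the left, while on the right every
  finite subsum is simply dominated by the full one.
\<close>

theorem stein_inequality:
  fixes f :: "'a set \<Rightarrow> 'a \<Rightarrow> real"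
  assumes p: "1 < p" and D: "countable D" "D \<subseteq> sets M"
    and nested: "\<And>Q R. Q \<in> D \<Longrightarrow> R \<in> D \<Longrightarrow> Q \<subseteq> R \<or> R \<subseteq> Q \<or> Q \<inter> R = {}"
    and fin: "\<And>Q. Q \<in> D \<Longrightarrow> emeasure M Q < \<infinity>"
    and int: "\<And>Q. Q \<in> D \<Longrightarrow> set_integrable M Q (f Q)"
  defines "a \<equiv> \<lambda>Q. (LINT y:Q|M. f Q y) / measure M Q"
  shows "Lp_norm p M (square_function D (\<lambda>Q _. a Q))
    \<le> ennreal (stein_const p) * Lp_norm p M (square_function D f)"
proof -
  define G where "G n = {Q\<in>D. to_nat_on D Q < n}" for n :: nat
  have G: "finite (G n)" for n
    unfolding G_def by (rule finite_initial_segment[OF D(1)])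
  have GD: "G n \<subseteq> D" for n by (auto simp: G_def)
  have power: "ennpowr (square_function D g x) p
      = (SUP n. ennreal ((\<Sum>Q\<in>G n. (g Q x)\<^sup>2 * indicator Q x) powr (p / 2)))" for g x
  proof -
    have "ennpowr (square_function D g x) p
        = ennpowr (SUP n. \<Sum>Q\<in>G n. ennreal ((g Q x)\<^sup>2) * indicator Q x) (p / 2)"
      unfolding square_function_def ennpowr_ennpowr ennreal_infsum_eq_SUP[OF D(1)] G_def by simp
    also have "\<dots> = (SUP n. ennpowr (\<Sum>Q\<in>G n. ennreal ((g Q x)\<^sup>2) * indicator Q x) (p / 2))"
      by (rule ennpowr_SUP) (use p in simp)
    also have "(\<Sum>Q\<in>G n. ennreal ((g Q x)\<^sup>2) * indicator Q x)
        = ennreal (\<Sum>Q\<in>G n. (g Q x)\<^sup>2 * indicator Q x)" for n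
      by (subst sum_ennreal[symmetric]) (auto simp: ennreal_mult' ennreal_indicator)
    hence "(SUP n. ennpowr (\<Sum>Q\<in>G n. ennreal ((g Q x)\<^sup>2) * indicator Q x) (p / 2))
        = (SUP n. ennreal ((\<Sum>Q\<in>G n. (g Q x)\<^sup>2 * indicator Q x) powr (p / 2)))"
      by (simp add: ennpowr_ennreal sum_nonneg)
    finally show ?thesis .
  qed
  let ?S = "\<lambda>n x. ennreal ((\<Sum>Q\<in>G n. (a Q)\<^sup>2 * indicator Q x) powr (p / 2))"
  have "(\<integral>\<^sup>+x. ennpowr (square_function D (\<lambda>Q _. a Q) x) p \<partial>M) = (\<integral>\<^sup>+x. (SUP n. ?S n x) \<partial>M)"
    by (simp only: power)
  also have "\<dots> = (SUP n. \<integral>\<^sup>+x. ?S n x \<partial>M)"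
  proof (rule nn_integral_monotone_convergence_SUP)
    show "incseq ?S"
      unfolding incseq_def le_fun_def using p G
      by (intro allI impI ennreal_leI powr_mono2 sum_mono2) (auto simp: G_def intro!: sum_nonneg)
    show "?S n \<in> borel_measurable M" for n
    proof -
      have "(\<lambda>x. \<Sum>Q\<in>G n. (a Q)\<^sup>2 * indicator Q x) \<in> borel_measurable M"
        by (intro borel_measurable_sum borel_measurable_times borel_measurable_indicator)
          (use GD[of n] D in auto)
      thus ?thesis by measurable
    qed
  qed
  also have "\<dots> \<le> ennreal (stein_const p powr p) * (\<integral>\<^sup>+x. ennpowr (square_function D f x) p \<partial>M)"
  proof (rule SUP_least)
    fix n
    have "(\<integral>\<^sup>+x. ?S n x \<partial>M) \<le> ennreal (stein_const p powr p) *
       (\<integral>\<^sup>+x. ennreal ((\<Sum>Q\<in>G n. (f Q x)\<^sup>2 * indicator Q x) powr (p / 2)) \<partial>M)"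
      unfolding a_def
      by (rule stein_inequality_finite) (use p G[of n] GD[of n] D nested fin int in \<open>blast+\<close>)
    also have "\<dots> \<le> ennreal (stein_const p powr p) * (\<integral>\<^sup>+x. ennpowr (square_function D f x) p \<partial>M)"
      unfolding power by (intro mult_left_mono nn_integral_mono SUP_upper) auto
    finally show "(\<integral>\<^sup>+x. ?S n x \<partial>M)
      \<le> ennreal (stein_const p powr p) * (\<integral>\<^sup>+x. ennpowr (square_function D f x) p \<partial>M)" .
  qed
  finally have "Lp_norm p M (square_function D (\<lambda>Q _. a Q))
    \<le> ennpowr (ennreal (stein_const p powr p) * (\<integral>\<^sup>+x. ennpowr (square_function D f x) p \<partial>M)) (1 / p)"
    unfolding Lp_norm_def using p by (intro ennpowr_mono) auto
  also have "\<dots> = ennreal (stein_const p) * Lp_norm p M (square_function D f)"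
    unfolding Lp_norm_def using p stein_const_pos[of p]
    by (subst ennpowr_cmult) (simp_all add: powr_powr)
  finally show ?thesis .
qed

section \<open>Compact sets and dyadic cubes\<close>

text \<open>
  The product sigma-algebra contains the open sets because each of them is a union of boxes whose
  sides are taken from a countable basis of the line, and there are only countably many such boxes.
\<close>

lemma openin_Rn_measurable:
  assumes "openin (Rn_topology N) U"
  shows "U \<in> sets (Rn_borel N)"
proof -
  obtain \<B> :: "real set set" where B: "countable \<B>" "topological_basis \<B>"
    using ex_countable_basis by auto
  define F where "F = {X \<in> (\<Pi>\<^sub>E i\<in>{..<N}. \<B>). (\<Pi>\<^sub>E i\<in>{..<N}. X i) \<subseteq> U}"
  have "countable F"
    unfolding F_def by (rule countable_subset[of _ "\<Pi>\<^sub>E i\<in>{..<N}. \<B>"]) (auto intro!: countable_PiE B)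
  have "U \<subseteq> (\<Union>X\<in>F. \<Pi>\<^sub>E i\<in>{..<N}. X i)"
  proof
    fix z assume "z \<in> U"
    then obtain V where V: "\<forall>i\<in>{..<N}. open (V i)" "z \<in> (\<Pi>\<^sub>E i\<in>{..<N}. V i)" "(\<Pi>\<^sub>E i\<in>{..<N}. V i) \<subseteq> U"
      using assms unfolding openin_product_topology_alt by (auto simp: open_openin[symmetric])
    have "\<exists>Y\<in>\<B>. z i \<in> Y \<and> Y \<subseteq> V i" if "i < N" for i
      using topological_basisE[OF B(2), of "V i" "z i"] V(1,2) that by (metis PiE_mem lessThan_iff)
    then obtain Y where Y: "\<And>i. i < N \<Longrightarrow> Y i \<in> \<B> \<and> z i \<in> Y i \<and> Y i \<subseteq> V i"
      by metis
    have sub: "(\<Pi>\<^sub>E i\<in>{..<N}. Y i) \<subseteq> U"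
      using PiE_mono[of "{..<N}" Y V] Y V(3) by auto
    have "(\<Pi>\<^sub>E i\<in>{..<N}. restrict Y {..<N} i) = (\<Pi>\<^sub>E i\<in>{..<N}. Y i)"
      by (rule PiE_cong) simp
    with sub have "(\<Pi>\<^sub>E i\<in>{..<N}. restrict Y {..<N} i) \<subseteq> U" by simp
    moreover have "restrict Y {..<N} \<in> (\<Pi>\<^sub>E i\<in>{..<N}. \<B>)" using Y by auto
    ultimately have "restrict Y {..<N} \<in> F"
      unfolding F_def by blast
    moreover have "z \<in> (\<Pi>\<^sub>E i\<in>{..<N}. restrict Y {..<N} i)"
      using Y V(2) by (auto simp: PiE_iff)
    ultimately show "z \<in> (\<Union>X\<in>F. \<Pi>\<^sub>E i\<in>{..<N}. X i)" by blast
  qed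
  hence "U = (\<Union>X\<in>F. \<Pi>\<^sub>E i\<in>{..<N}. X i)" by (auto simp: F_def)
  also have "\<dots> \<in> sets (Rn_borel N)"
  proof (rule sets.countable_UN'[OF \<open>countable F\<close>], safe)
    fix X assume "X \<in> F"
    hence "X i \<in> \<B>" if "i < N" for i using that by (auto simp: F_def PiE_iff)
    thus "(\<Pi>\<^sub>E i\<in>{..<N}. X i) \<in> sets (Rn_borel N)"
      using topological_basis_open[OF B(2)] by (intro sets_PiM_I_finite) auto
  qed
  finally show ?thesis .
qed

lemma compactin_Rn_measurable:
  assumes "compactin (Rn_topology N) K"
  shows "K \<in> sets (Rn_borel N)"
proof -
  have K: "closedin (Rn_topology N) K"
    by (rule compactin_imp_closedin[OF _ assms]) (simp add: Hausdorff_space_product_topology)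
  have top: "topspace (Rn_topology N) = space (Rn_borel N)"
    by (simp add: space_PiM)
  have "space (Rn_borel N) - K \<in> sets (Rn_borel N)"
    using K unfolding closedin_def top by (intro openin_Rn_measurable) simp
  hence "space (Rn_borel N) - (space (Rn_borel N) - K) \<in> sets (Rn_borel N)"
    by (rule sets.compl_sets)
  moreover have "K \<subseteq> space (Rn_borel N)"
    using K unfolding closedin_def top by simp
  ultimately show ?thesis by (simp add: double_diff)
qed

lemma dyadic_cube_measurable:
  "dyadic_cube N k x \<in> sets (Rn_borel N)"
  unfolding dyadic_cube_def by (rule sets_PiM_I_finite) auto

lemma dyadic_cube_in_compact:
  obtains K where "compactin (Rn_topology N) K" "dyadic_cube N k x \<subseteq> K"
proof
  show "compactin (Rn_topology N) (\<Pi>\<^sub>E i\<in>{..<N}. {x i .. x i + 2 powi (-k)})"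
    by (simp add: compactin_PiE)
  show "dyadic_cube N k x \<subseteq> (\<Pi>\<^sub>E i\<in>{..<N}. {x i .. x i + 2 powi (-k)})"
    unfolding dyadic_cube_def by (rule PiE_mono) auto
qed

lemma dyadic_cube_rational_point:
  "\<exists>t\<in>(\<Pi>\<^sub>E i\<in>{..<N}. \<rat>). t \<in> dyadic_cube N k x"
proof -
  have "\<exists>r\<in>\<rat>. x i < r \<and> r < x i + 2 powi (-k)" for i
    by (rule Rats_dense_in_real) simp
  then obtain r where r: "\<And>i. r i \<in> \<rat>" "\<And>i. x i < r i" "\<And>i. r i < x i + 2 powi (-k)"
    by metis
  show ?thesis
    by (rule bexI[of _ "restrict r {..<N}"]) (use r in \<open>auto simp: dyadic_cube_def less_imp_le\<close>)
qed

lemma dyadic_latticeD: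
  assumes "dyadic_lattice N \<D>"
  shows dyadic_lattice_cube: "Q \<in> \<D> k \<Longrightarrow> \<exists>x\<in>Rn_space N. Q = dyadic_cube N k x"
    and dyadic_lattice_disjoint: "disjoint (\<D> k)"
    and dyadic_lattice_cover: "\<Union>(\<D> k) = Rn_space N"
    and dyadic_lattice_refine: "Q \<in> \<D> k \<Longrightarrow> \<exists>\<C>\<subseteq>\<D> (k + 1). card \<C> = 2 ^ N \<and> Q = \<Union>\<C>"
proof -
  note * = assms[unfolded dyadic_lattice_def, THEN spec, of k]
  show "Q \<in> \<D> k \<Longrightarrow> \<exists>x\<in>Rn_space N. Q = dyadic_cube N k x"
    by (rule *[THEN conjunct1, THEN bspec])
  show "disjoint (\<D> k)" by (rule *[THEN conjunct2, THEN conjunct1])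
  show "\<Union>(\<D> k) = Rn_space N" by (rule *[THEN conjunct2, THEN conjunct2, THEN conjunct1])
  show "Q \<in> \<D> k \<Longrightarrow> \<exists>\<C>\<subseteq>\<D> (k + 1). card \<C> = 2 ^ N \<and> Q = \<Union>\<C>"
    by (rule *[THEN conjunct2, THEN conjunct2, THEN conjunct2, THEN bspec])
qed

text \<open>
  Each generation is countable: its cubes are disjoint and each contains a rational point.
\<close>

lemma dyadic_lattice_countable:
  assumes "dyadic_lattice N \<D>"
  shows "countable (\<Union>k. \<D> k)"
proof (rule countable_UN)
  fix k
  let ?T = "\<Pi>\<^sub>E i\<in>{..<N}. \<rat> :: real set"
  note disj = dyadic_lattice_disjoint[OF assms, of k]
  have "\<exists>t. t \<in> ?T \<and> t \<in> Q" if Q: "Q \<in> \<D> k" for Q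
  proof -
    obtain x where "Q = dyadic_cube N k x" using dyadic_lattice_cube[OF assms Q] ..
    thus ?thesis using dyadic_cube_rational_point[of N k x] by blast
  qed
  hence "\<forall>Q\<in>\<D> k. \<exists>t. t \<in> ?T \<and> t \<in> Q" by blast
  from bchoice[OF this] obtain t where t: "\<And>Q. Q \<in> \<D> k \<Longrightarrow> t Q \<in> ?T \<and> t Q \<in> Q"
    by blast
  have "inj_on t (\<D> k)"
  proof (rule inj_onI)
    fix Q R assume QR: "Q \<in> \<D> k" "R \<in> \<D> k" "t Q = t R"
    hence "t Q \<in> Q \<inter> R" using t[of Q] t[of R] by auto
    thus "Q = R" using disjointD[OF disj QR(1,2)] by blast
  qed
  moreover have "countable (t ` \<D> k)"
    by (rule countable_subset[of _ ?T]) (use t in \<open>auto intro!: countable_PiE countable_rat\<close>)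
  ultimately show "countable (\<D> k)"
    using countable_image_inj_on by blast
qed simp

text \<open>
  The point \<open>z\<close> determines the cube of each generation that contains it. By refinement, the one of
  generation \<open>k + 1\<close> is contained in the one of generation \<open>k\<close>.
\<close>

lemma dyadic_lattice_finer_cube:
  assumes D: "dyadic_lattice N \<D>" and "Q \<in> \<D> j" and "R \<in> \<D> (j + int n)" and "z \<in> Q" "z \<in> R"
  shows "R \<subseteq> Q"
  using assms(3,5)
proof (induction n arbitrary: R)
  case 0
  note dyadic_lattice_disjoint[OF D, of j]
  moreover have "R \<in> \<D> j" using 0 by simp
  moreover have "Q \<inter> R \<noteq> {}" using \<open>z \<in> Q\<close> 0 by (metis IntI empty_iff)
  ultimately have "Q = R" using disjointD[of "\<D> j" Q R] \<open>Q \<in> \<D> j\<close> by metis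
  thus ?case by simp
next
  case (Suc n)
  have step: "j + int (Suc n) = j + int n + 1" by simp
  note disj = dyadic_lattice_disjoint[OF D, of "j + int (Suc n)"]
  have "z \<in> \<Union>(\<D> (j + int (Suc n)))" using Suc.prems by (rule UnionI)
  hence "z \<in> \<Union>(\<D> (j + int n))" by (simp only: dyadic_lattice_cover[OF D])
  then obtain P where P: "P \<in> \<D> (j + int n)" "z \<in> P" by (rule UnionE)
  obtain \<C> where C: "\<C> \<subseteq> \<D> (j + int (Suc n))" "P = \<Union>\<C>"
    using dyadic_lattice_refine[OF D P(1)] unfolding step by metis
  have "z \<in> \<Union>\<C>" using P(2) C(2) by simp
  then obtain R' where R': "R' \<in> \<C>" "z \<in> R'" by (rule UnionE)
  have "R' \<in> \<D> (j + int (Suc n))" using C(1) R'(1) by (rule subsetD)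
  moreover have "R \<inter> R' \<noteq> {}" using R'(2) Suc.prems(2) by (metis IntI empty_iff)
  ultimately have "R = R'" using disjointD[OF disj Suc.prems(1)] by metis
  hence "R \<subseteq> P" using R'(1) C(2) by (simp add: Union_upper)
  also have "P \<subseteq> Q" by (rule Suc.IH[OF P])
  finally show ?case .
qed

lemma dyadic_lattice_nested:
  assumes D: "dyadic_lattice N \<D>" and "Q \<in> (\<Union>k. \<D> k)" "R \<in> (\<Union>k. \<D> k)"
  shows "Q \<subseteq> R \<or> R \<subseteq> Q \<or> Q \<inter> R = {}"
proof (cases "Q \<inter> R = {}")
  case False
  then obtain z where z: "z \<in> Q" "z \<in> R" by blast
  obtain j k where jk: "Q \<in> \<D> j" "R \<in> \<D> k" using assms(2,3) by (elim UN_E)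
  show ?thesis
  proof (cases "j \<le> k")
    case True
    thus ?thesis using dyadic_lattice_finer_cube[OF D jk(1), of R "nat (k - j)" z] jk(2) z by simp
  next
    case False
    thus ?thesis using dyadic_lattice_finer_cube[OF D jk(2), of Q "nat (j - k)" z] jk(1) z by simp
  qed
qed simp

lemma radon_measure_cube:
  assumes "dyadic_lattice N \<D>" "radon_measure N \<sigma>" "Q \<in> (\<Union>k. \<D> k)"
  shows "Q \<in> sets \<sigma>" and "emeasure \<sigma> Q < \<infinity>"
    and "locally_integrable N \<sigma> f \<Longrightarrow> set_integrable \<sigma> Q f"
proof -
  obtain k x where Q: "Q = dyadic_cube N k x"
    using assms(3) dyadic_lattice_cube[OF assms(1)] by (metis UN_E)
  obtain K where K: "compactin (Rn_topology N) K" "Q \<subseteq> K"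
    using dyadic_cube_in_compact[of N k x] Q by metis
  have Ks: "K \<in> sets \<sigma>"
    using assms(2) compactin_Rn_measurable[OF K(1)] by (simp add: radon_measure_def)
  show Qs: "Q \<in> sets \<sigma>"
    using assms(2) dyadic_cube_measurable by (simp add: radon_measure_def Q)
  show "emeasure \<sigma> Q < \<infinity>"
    using emeasure_mono[OF K(2) Ks] assms(2) K(1) by (auto simp: radon_measure_def)
  show "set_integrable \<sigma> Q f" if "locally_integrable N \<sigma> f"
    using that K Qs by (auto simp: locally_integrable_def intro: set_integrable_subset)
qed

lemma locally_integrable_const:
  assumes "radon_measure N \<sigma>"
  shows "locally_integrable N \<sigma> (\<lambda>_. c)"
  unfolding locally_integrable_def
proof (intro conjI allI impI)
  fix K assume K: "compactin (Rn_topology N) K"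
  have "emeasure \<sigma> K < \<infinity>" using assms K by (simp add: radon_measure_def)
  moreover have "K \<in> sets \<sigma>"
    using assms compactin_Rn_measurable[OF K] by (simp add: radon_measure_def)
  ultimately show "set_integrable \<sigma> K (\<lambda>_. c)"
    unfolding set_integrable_def by (intro integrable_scaleR_left impI integrable_real_indicator)
qed simp

section \<open>Comparison of the two constants\<close>

text \<open>
  Constants are locally integrable, so every constant admissible for averages of functions is
  admissible for numbers.
\<close>

lemma quadratic_A_const_le_averaging_const:
  assumes "dyadic_lattice N \<D>" and \<sigma>: "radon_measure N \<sigma>"
  shows "quadratic_A_const N \<D> p q \<sigma> w \<le> averaging_const N \<D> p q \<sigma> w"
  unfolding quadratic_A_const_def averaging_const_def
proof (rule Inf_superset_mono, safe)
  fix C :: ennreal and a :: "(nat \<Rightarrow> real) set \<Rightarrow> real"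
  assume C: "\<forall>f. (\<forall>Q\<in>\<Union>k. \<D> k. locally_integrable N \<sigma> (f Q)) \<longrightarrow>
    Lp_norm q w (square_function (\<Union>k. \<D> k)
      (\<lambda>Q _. (LINT y:Q|\<sigma>. f Q y) / measure (Rn_lebesgue N) Q))
    \<le> C * Lp_norm p \<sigma> (square_function (\<Union>k. \<D> k) f)"
  have "(LINT y:Q|\<sigma>. a Q) = a Q * measure \<sigma> Q" if "Q \<in> (\<Union>k. \<D> k)" for Q
    using radon_measure_cube(1)[OF assms that] sets.Int_space_eq2[of Q \<sigma>]
    by (simp add: set_lebesgue_integral_def)
  hence "square_function (\<Union>k. \<D> k) (\<lambda>Q _. (LINT y:Q|\<sigma>. a Q) / measure (Rn_lebesgue N) Q)
      = square_function (\<Union>k. \<D> k) (\<lambda>Q _. a Q * (measure \<sigma> Q / measure (Rn_lebesgue N) Q))"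
    unfolding square_function_def by (intro ext arg_cong2[of _ _ _ _ ennpowr] infsum_cong) auto
  thus "Lp_norm q w (square_function (\<Union>k. \<D> k) (\<lambda>Q _. a Q * (measure \<sigma> Q / measure (Rn_lebesgue N) Q)))
      \<le> C * Lp_norm p \<sigma> (square_function (\<Union>k. \<D> k) (\<lambda>Q _. a Q))"
    using C[rule_format, of "\<lambda>Q _. a Q"] locally_integrable_const[OF \<sigma>] by simp
qed

text \<open>
  The quadratic inequality is applied to the averages of the \<open>f Q\<close>, and Stein's inequality bounds its
  right-hand side. The multiplicative constant passes through the infimum by division, since it is
  positive and finite.
\<close>

lemma averaging_const_le_quadratic_A_const:
  assumes p: "1 < p" and D: "dyadic_lattice N \<D>" and \<sigma>: "radon_measure N \<sigma>"
  shows "averaging_const N \<D> p q \<sigma> w \<le> ennreal (stein_const p) * quadratic_A_const N \<D> p q \<sigma> w"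
proof -
  let ?D = "\<Union>k. \<D> k" and ?K = "ennreal (stein_const p)"
  have K: "?K \<noteq> 0" "?K \<noteq> \<infinity>" using stein_const_pos[of p] by auto
  have *: "averaging_const N \<D> p q \<sigma> w \<le> ?K * C"
    if C: "\<forall>a. Lp_norm q w (square_function ?D (\<lambda>Q _. a Q * (measure \<sigma> Q / measure (Rn_lebesgue N) Q)))
       \<le> C * Lp_norm p \<sigma> (square_function ?D (\<lambda>Q _. a Q))" for C
    unfolding averaging_const_def
  proof (rule Inf_lower, safe)
    fix f :: "(nat \<Rightarrow> real) set \<Rightarrow> (nat \<Rightarrow> real) \<Rightarrow> real"
    assume f: "\<forall>Q\<in>?D. locally_integrable N \<sigma> (f Q)"
    define a where "a Q = (LINT y:Q|\<sigma>. f Q y) / measure \<sigma> Q" for Q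
    \<comment> \<open>If \<open>\<sigma>\<close> does not charge \<open>Q\<close>, the average is \<open>0\<close> by the convention for division, and the
      integral over \<open>Q\<close> vanishes as well.\<close>
    have "a Q * measure \<sigma> Q = (LINT y:Q|\<sigma>. f Q y)" if "Q \<in> ?D" for Q
    proof (cases "measure \<sigma> Q = 0")
      case True
      hence "Q \<in> null_sets \<sigma>"
        using radon_measure_cube(1,2)[OF D \<sigma> that] by (auto simp: measure_def enn2real_eq_0_iff)
      hence "(LINT y:Q|\<sigma>. f Q y) = 0"
        unfolding set_lebesgue_integral_def
        by (intro integral_eq_zero_AE AE_I'[of Q]) (auto simp: indicator_def)
      thus ?thesis using True by simp
    qed (simp add: a_def)
    hence "square_function ?D (\<lambda>Q _. (LINT y:Q|\<sigma>. f Q y) / measure (Rn_lebesgue N) Q)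
      = square_function ?D (\<lambda>Q _. a Q * (measure \<sigma> Q / measure (Rn_lebesgue N) Q))"
      unfolding square_function_def by (intro ext arg_cong2[of _ _ _ _ ennpowr] infsum_cong) auto
    hence "Lp_norm q w (square_function ?D (\<lambda>Q _. (LINT y:Q|\<sigma>. f Q y) / measure (Rn_lebesgue N) Q))
      \<le> C * Lp_norm p \<sigma> (square_function ?D (\<lambda>Q _. a Q))"
      using C by simp
    also have "\<dots> \<le> C * (?K * Lp_norm p \<sigma> (square_function ?D f))"
      unfolding a_def
    proof (rule mult_left_mono[OF stein_inequality[OF p dyadic_lattice_countable[OF D]]])
      show "?D \<subseteq> sets \<sigma>" using radon_measure_cube(1)[OF D \<sigma>] by (rule subsetI)
      show "Q \<subseteq> R \<or> R \<subseteq> Q \<or> Q \<inter> R = {}" if "Q \<in> ?D" "R \<in> ?D" for Q R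
        using dyadic_lattice_nested[OF D that] .
      show "emeasure \<sigma> Q < \<infinity>" if "Q \<in> ?D" for Q
        using radon_measure_cube(2)[OF D \<sigma> that] .
      show "set_integrable \<sigma> Q (f Q)" if "Q \<in> ?D" for Q
        using radon_measure_cube(3)[OF D \<sigma> that] f[rule_format, OF that] .
    qed simp
    finally show "Lp_norm q w (square_function ?D (\<lambda>Q _. (LINT y:Q|\<sigma>. f Q y) / measure (Rn_lebesgue N) Q))
      \<le> ?K * C * Lp_norm p \<sigma> (square_function ?D f)"
      by (simp only: mult_ac)
  qed
  have "averaging_const N \<D> p q \<sigma> w / ?K \<le> quadratic_A_const N \<D> p q \<sigma> w"
    unfolding quadratic_A_const_def
  proof (rule Inf_greatest)
    fix C assume "C \<in> {C. \<forall>a. Lp_norm q w (square_function ?D (\<lambda>Q _. a Q * (measure \<sigma> Q / measure (Rn_lebesgue N) Q)))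
       \<le> C * Lp_norm p \<sigma> (square_function ?D (\<lambda>Q _. a Q))}"
    hence "averaging_const N \<D> p q \<sigma> w \<le> ?K * C" by (intro *) (rule CollectD)
    hence "averaging_const N \<D> p q \<sigma> w / ?K \<le> (?K * C) / ?K" by (rule divide_right_mono_ennreal)
    also have "\<dots> = C"
      using K unfolding mult.commute[of ?K C] by (intro ennreal_mult_divide_eq) auto
    finally show "averaging_const N \<D> p q \<sigma> w / ?K \<le> C" .
  qed
  hence "?K * (averaging_const N \<D> p q \<sigma> w / ?K) \<le> ?K * quadratic_A_const N \<D> p q \<sigma> w"
    by (rule mult_left_mono) simp
  also have "?K * (averaging_const N \<D> p q \<sigma> w / ?K) = averaging_const N \<D> p q \<sigma> w"
    unfolding ennreal_times_divide mult.commute[of ?K "averaging_const N \<D> p q \<sigma> w"]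
    using K by (intro ennreal_mult_divide_eq) auto
  finally show ?thesis .
qed

theorem lemma3p2:
  fixes p q :: real
  assumes "1 < p" and "1 < q"
  shows "\<exists>c C :: real. 0 < c \<and> 0 < C \<and>
    (\<forall>N \<D> \<sigma> w. 1 \<le> N \<longrightarrow> dyadic_lattice N \<D> \<longrightarrow> radon_measure N \<sigma> \<longrightarrow> radon_measure N w \<longrightarrow>
      ennreal c * quadratic_A_const N \<D> p q \<sigma> w \<le> averaging_const N \<D> p q \<sigma> w \<and>
      averaging_const N \<D> p q \<sigma> w \<le> ennreal C * quadratic_A_const N \<D> p q \<sigma> w \<and>
      (averaging_const N \<D> p q \<sigma> w < \<infinity> \<longleftrightarrow> quadratic_A_const N \<D> p q \<sigma> w < \<infinity>))"
proof (rule exI[of _ 1], rule exI[of _ "stein_const p"], intro conjI allI impI)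
  fix N \<D> \<sigma> w
  assume *: "dyadic_lattice N \<D>" "radon_measure N \<sigma>"
  note le = quadratic_A_const_le_averaging_const[OF *, of p q w]
    averaging_const_le_quadratic_A_const[OF assms(1) *, of q w]
  show "ennreal 1 * quadratic_A_const N \<D> p q \<sigma> w \<le> averaging_const N \<D> p q \<sigma> w"
    using le(1) by simp
  show "averaging_const N \<D> p q \<sigma> w \<le> ennreal (stein_const p) * quadratic_A_const N \<D> p q \<sigma> w"
    by (rule le(2))
  have "averaging_const N \<D> p q \<sigma> w < \<infinity>" if "quadratic_A_const N \<D> p q \<sigma> w < \<infinity>"
    using le(2) that by (simp add: ennreal_mult_less_top le_less_trans)
  thus "averaging_const N \<D> p q \<sigma> w < \<infinity> \<longleftrightarrow> quadratic_A_const N \<D> p q \<sigma> w < \<infinity>"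
    using le(1) by (auto intro: le_less_trans)
qed (simp_all add: stein_const_pos)

end
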